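(* Let $G$ be a finite abelian group of order $n$ (identity $e$) such that the generalized dihedral group $D(G)$ is non-abelian, let $r\ge1$ satisfy $2^r=|\{g\in G:g^2=e\}|$ (i.e. the center of $D(G)$ has at least $2$ elements), write $b=n/2^r$, and let $\Gamma=\mathfrak{C}(D(G),D(G))$. Then the resolving polynomial of $\Gamma$ is \[\beta(\Gamma,x)=(n-2^r)(2^r)^{b+1}x^{2n-b-2}+\sum_{i=2n-b-1}^{2n-2}s_ix^{i}+2nx^{2n-1}+x^{2n},\] where for $2n-b-1\le i\le 2n-2$, \[s_i=(n-2^r)(2^r)^{2n-i-1}\binom{b+1}{2n-i-1}+(2^r)^{2n-i}\binom{b+1}{2n-i}.\]
   Context: $D(G)=G\rtimes C_2$, $C_2=\{1,-1\}$, has elements $(g,c)$ with multiplication $(g_1,c_1)(g_2,c_2)=(g_1g_2^{c_1},c_1c_2)$; its center is $\{(g,1):g^2=e\}$, of size $2^r$. The commuting graph $\mathfrak{C}(D(G),D(G))$ is the simple graph with vertex set $D(G)$ in which distinct $u,v$ are adjacent iff $uv=vu$. A set $W$ of vertices of a connected graph is resolving if every vertex is uniquely determined by its vector of shortest-path distances to the vertices of $W$; $\beta(\Gamma)$ is the minimum size of a resolving set. The resolving polynomial is $\beta(\Gamma,x)=\sum_{i=\beta(\Gamma)}^{|V(\Gamma)|}s_ix^i$, where $s_i$ is the number of resolving sets of cardinality $i$. *)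

theory Defs
  imports
    "HOL-Algebra.Coset"
    "HOL-Computational_Algebra.Polynomial"
    "Graph_Theory.Graph_Theory"
begin

text \<open>The group \<open>D(G) = G \<rtimes> C\<^sub>2\<close>, with \<open>C\<^sub>2 = {1, -1}\<close> taken inside \<^typ>\<open>int\<close>, so that
  \<open>g\<^sub>2\<close> to the power \<open>c\<^sub>1\<close> is the integer power of HOL-Algebra.\<close>

definition gen_dihedral :: "('a, 'm) monoid_scheme \<Rightarrow> ('a \<times> int) monoid" where
  "gen_dihedral G =
    \<lparr> carrier = carrier G \<times> {1, -1},
      monoid.mult = (\<lambda>(g1, c1) (g2, c2). (g1 \<otimes>\<^bsub>G\<^esub> (g2 [^]\<^bsub>G\<^esub> c1), c1 * c2)),
      one = (\<one>\<^bsub>G\<^esub>, 1) \<rparr>"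

lemma group_gen_dihedral:
  assumes "comm_group G"
  shows "group (gen_dihedral G)"
proof -
  interpret comm_group G by (fact assms)
  have inv_pow: "x [^]\<^bsub>G\<^esub> (-1 :: int) = inv\<^bsub>G\<^esub> x" if "x \<in> carrier G" for x
    using that by (simp add: int_pow_neg)
  show ?thesis
  proof (rule groupI)
    fix x assume "x \<in> carrier (gen_dihedral G)"
    then obtain g c where x: "x = (g, c)" "g \<in> carrier G" "c = 1 \<or> c = -1"
      by (auto simp: gen_dihedral_def)
    let ?y = "(if c = 1 then (inv\<^bsub>G\<^esub> g, 1) else (g, -1)) :: 'a \<times> int"
    have "?y \<in> carrier (gen_dihedral G)"
      and "?y \<otimes>\<^bsub>gen_dihedral G\<^esub> x = \<one>\<^bsub>gen_dihedral G\<^esub>"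
      using x by (auto simp: gen_dihedral_def inv_pow)
    then show "\<exists>y\<in>carrier (gen_dihedral G). y \<otimes>\<^bsub>gen_dihedral G\<^esub> x = \<one>\<^bsub>gen_dihedral G\<^esub>"
      by blast
  qed (auto simp: gen_dihedral_def inv_pow m_assoc inv_mult)
qed

text \<open>A simple graph is a symmetric loop-free digraph: an edge \<open>uv\<close> is the pair of arcs
  \<open>(u, v)\<close>, \<open>(v, u)\<close>.\<close>

definition commuting_graph :: "('a, 'm) monoid_scheme \<Rightarrow> 'a set \<Rightarrow> 'a pair_pre_digraph" where
  "commuting_graph H \<Omega> =
    \<lparr> pverts = \<Omega>,
      parcs = {(u, v). u \<in> \<Omega> \<and> v \<in> \<Omega> \<and> u \<noteq> v \<and> u \<otimes>\<^bsub>H\<^esub> v = v \<otimes>\<^bsub>H\<^esub> u} \<rparr>"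

lemma pair_graph_commuting_graph:
  assumes "finite \<Omega>"
  shows "pair_graph (commuting_graph H \<Omega>)"
proof
  have "parcs (commuting_graph H \<Omega>) \<subseteq> \<Omega> \<times> \<Omega>"
    by (auto simp: commuting_graph_def)
  then show "finite (parcs (commuting_graph H \<Omega>))"
    using assms by (meson finite_SigmaI finite_subset)
  show "symmetric (with_proj (commuting_graph H \<Omega>))"
    by (auto simp: symmetric_def arcs_ends_def commuting_graph_def arc_to_ends_def
        with_proj_def intro!: symI)
qed (use assms in \<open>auto simp: commuting_graph_def\<close>)

definition graph_dist :: "('v, 'e) pre_digraph \<Rightarrow> 'v \<Rightarrow> 'v \<Rightarrow> ereal" where
  "graph_dist \<Gamma> u v = wf_digraph.\<mu> \<Gamma> (\<lambda>_. 1) u v"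

definition resolving_set :: "('v, 'e) pre_digraph \<Rightarrow> 'v set \<Rightarrow> bool" where
  "resolving_set \<Gamma> W \<longleftrightarrow> W \<subseteq> verts \<Gamma> \<and>
    (\<forall>u\<in>verts \<Gamma>. \<forall>v\<in>verts \<Gamma>. (\<forall>w\<in>W. graph_dist \<Gamma> u w = graph_dist \<Gamma> v w) \<longrightarrow> u = v)"

text \<open>The following notions are meant for finite graphs only, where every resolving set has a
  genuine cardinality and the whole vertex set is resolving.\<close>

definition metric_dimension :: "('v, 'e) pre_digraph \<Rightarrow> nat" where
  "metric_dimension \<Gamma> = (LEAST k. \<exists>W. resolving_set \<Gamma> W \<and> card W = k)"

definition num_resolving_sets :: "('v, 'e) pre_digraph \<Rightarrow> nat \<Rightarrow> nat" where
  "num_resolving_sets \<Gamma> i = card {W. resolving_set \<Gamma> W \<and> card W = i}"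

definition resolving_polynomial :: "('v, 'e) pre_digraph \<Rightarrow> int poly" where
  "resolving_polynomial \<Gamma> =
    (\<Sum>i = metric_dimension \<Gamma>..card (verts \<Gamma>). monom (int (num_resolving_sets \<Gamma> i)) i)"

end

theory Submission
  imports Defs "HOL-Library.Disjoint_Sets"
begin

text \<open>
  Let \<open>H\<close> be the subgroup of elements of \<open>G\<close> of order at most 2, so \<open>|H| = 2\<^sup>r\<close>.  In the commuting graph
  the center \<open>H \<times> {1}\<close> is joined to everything, and what remains falls apart into the cliques
  \<open>(G - H) \<times> {1}\<close> and \<open>C \<times> {-1}\<close> for the \<open>b\<close> cosets \<open>C\<close> of \<open>H\<close>.  All distances are at most 2, and
  these \<open>b + 2\<close> sets are the classes of twins.  Since every class has at least two elements, a set
  is resolving iff it misses at most one vertex of each class.  Complements of resolving sets are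
  therefore partial transversals of a family of \<open>b + 1\<close> sets of size \<open>2\<^sup>r\<close> and one of size
  \<open>n - 2\<^sup>r\<close>, and the formula counts these by whether they meet the last set.
\<close>

section \<open>Distances up to two in a digraph\<close>

context wf_digraph
begin

text \<open>With unit weights the cost of a walk is its length, so a distance can be found by
  exhibiting one walk and bounding the length of all others from below.\<close>

lemma graph_dist_conv_length: "graph_dist G u v = (INF p\<in>{p. awalk u p v}. ereal (real (length p)))"
proof -
  have "awalk_cost (\<lambda>_. 1) p = real (length p)" for p :: "'b list"
    by (induction p) auto
  then show ?thesis
    by (simp add: graph_dist_def \<mu>_def)
qed

lemma graph_dist_eqI:
  assumes "awalk u p v" and "\<And>q. awalk u q v \<Longrightarrow> length p \<le> length q"
  shows "graph_dist G u v = ereal (real (length p))"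
  unfolding graph_dist_conv_length using assms
  by (intro antisym INF_greatest) (auto intro!: INF_lower2[of p])

lemma graph_dist_self: "u \<in> verts G \<Longrightarrow> graph_dist G u u = 0"
  using graph_dist_eqI[of u "[]" u] by (simp add: awalk_Nil_iff zero_ereal_def)

lemma graph_dist_adj:
  assumes "u \<noteq> v" and "u \<rightarrow>\<^bsub>G\<^esub> v"
  shows "graph_dist G u v = 1"
proof -
  from assms obtain a where a: "a \<in> arcs G" "tail G a = u" "head G a = v"
    by (auto simp: arcs_ends_conv)
  have "graph_dist G u v = ereal (real (length [a]))"
  proof (rule graph_dist_eqI)
    show "awalk u [a] v" using a by (auto simp: awalk_def)
    show "length [a] \<le> length q" if "awalk u q v" for q
      using that assms(1) by (cases q) (auto simp: awalk_Nil_iff)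
  qed
  then show ?thesis by (simp add: one_ereal_def)
qed

lemma graph_dist_two:
  assumes "u \<noteq> v" and "\<not> u \<rightarrow>\<^bsub>G\<^esub> v" and "u \<rightarrow>\<^bsub>G\<^esub> w" and "w \<rightarrow>\<^bsub>G\<^esub> v"
  shows "graph_dist G u v = 2"
proof -
  from assms obtain a a' where a: "a \<in> arcs G" "tail G a = u" "head G a = w"
    and a': "a' \<in> arcs G" "tail G a' = w" "head G a' = v"
    by (auto simp: arcs_ends_conv)
  have "graph_dist G u v = ereal (real (length [a, a']))"
  proof (rule graph_dist_eqI)
    show "awalk u [a, a'] v" using a a' by (auto simp: awalk_def)
    \<comment> \<open>A shorter walk is empty or a single arc; the first would give
      \<open>u = v\<close>, the second an arc from \<open>u\<close> to \<open>v\<close>.\<close>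
    show "length [a, a'] \<le> length q" if q: "awalk u q v" for q
    proof (rule ccontr)
      assume "\<not> ?thesis"
      then consider "q = []" | x where "q = [x]"
        by (cases q; cases "tl q") auto
      then show False
        using q assms(1,2) by cases (auto simp: awalk_def arcs_ends_conv)
    qed
  qed
  then show ?thesis by simp
qed

end

section \<open>Resolving sets of a graph made of twin classes\<close>

text \<open>Vertices of one class are twins, so only they themselves can tell each other apart, and
  at most one per class may be missed. Conversely such a \<open>W\<close> meets every class, and its
  members separate missed vertices of different classes. The graph is the clique \<open>Z\<close>
  joined to at least two disjoint cliques; the second of these is what separates a vertex of
  \<open>Z\<close> from a vertex of the first.\<close>

lemma resolving_set_iff_twin_classes:
  assumes wf: "wf_digraph \<Gamma>"
    and P: "\<Union>P = verts \<Gamma>" "disjoint P" and card_P: "\<And>C. C \<in> P \<Longrightarrow> 2 \<le> card C"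
    and Z: "Z \<in> P" and two: "C1 \<in> P - {Z}" "C2 \<in> P - {Z}" "C1 \<noteq> C2"
    and adj: "\<And>u v. u \<in> verts \<Gamma> \<Longrightarrow> v \<in> verts \<Gamma> \<Longrightarrow>
      u \<rightarrow>\<^bsub>\<Gamma>\<^esub> v \<longleftrightarrow> u \<noteq> v \<and> (u \<in> Z \<or> v \<in> Z \<or> (\<exists>C\<in>P. u \<in> C \<and> v \<in> C))"
  shows "resolving_set \<Gamma> W \<longleftrightarrow> W \<subseteq> verts \<Gamma> \<and> (\<forall>C\<in>P. card (C - W) \<le> 1)"
proof -
  interpret wf_digraph \<Gamma> by (fact wf)
  \<comment> \<open>Infinite sets have \<open>card\<close> 0, so the lower bound 2 forces
    finiteness.\<close>
  have fin: "finite C" if "C \<in> P" for C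
    using card_P[OF that] by (metis card.infinite not_numeral_le_zero)
  have sub: "C \<subseteq> verts \<Gamma>" if "C \<in> P" for C
    using that P by blast
  have uniq: "C = C'" if "C \<in> P" "C' \<in> P" "x \<in> C" "x \<in> C'" for C C' x
    using that P(2) unfolding disjoint_def by blast
  obtain z where z: "z \<in> Z"
    using card_P[OF Z] by fastforce
  \<comment> \<open>The vertex \<open>z\<close> of \<open>Z\<close> is a common neighbour of any two
    nonadjacent vertices, so no distance exceeds 2.\<close>
  have dist: "graph_dist \<Gamma> u v = (if u = v then 0 else if u \<rightarrow>\<^bsub>\<Gamma>\<^esub> v then 1 else 2)"
    if uv: "u \<in> verts \<Gamma>" "v \<in> verts \<Gamma>" for u v
  proof (cases "u = v \<or> u \<rightarrow>\<^bsub>\<Gamma>\<^esub> v")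
    case False
    then have "u \<noteq> z" "v \<noteq> z"
      using adj uv z by auto
    then show ?thesis
      using graph_dist_two[of u v z] adj[of u z] adj[of z v] uv z sub[OF Z] False by auto
  qed (use uv graph_dist_self graph_dist_adj in auto)
  have dist_eq_0: "graph_dist \<Gamma> u v = 0 \<longleftrightarrow> u = v" if "u \<in> verts \<Gamma>" "v \<in> verts \<Gamma>" for u v
    using dist[OF that] by simp
  have class_eq: "u \<rightarrow>\<^bsub>\<Gamma>\<^esub> v \<longleftrightarrow> C = C'"
    if "C \<in> P - {Z}" "C' \<in> P - {Z}" "u \<in> C" "v \<in> C'" "u \<noteq> v" for u v C C'
  proof -
    have "u \<notin> Z" "v \<notin> Z"
      using uniq[of C Z u] uniq[of C' Z v] that Z by auto
    moreover have "(\<exists>D\<in>P. u \<in> D \<and> v \<in> D) \<longleftrightarrow> C = C'"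
      using uniq[of C _ u] uniq[of C' _ v] that by (metis DiffD1)
    ultimately show ?thesis
      using adj[of u v] sub[of C] sub[of C'] that by auto
  qed
  have twins: "graph_dist \<Gamma> u w = graph_dist \<Gamma> v w"
    if "C \<in> P" "u \<in> C" "v \<in> C" "w \<in> verts \<Gamma>" "w \<noteq> u" "w \<noteq> v" for C u v w
  proof -
    have uv: "u \<in> verts \<Gamma>" "v \<in> verts \<Gamma>"
      using sub that by auto
    have "u \<in> D \<longleftrightarrow> v \<in> D" if "D \<in> P" for D
      using uniq[of C D u] uniq[of C D v] \<open>C \<in> P\<close> \<open>u \<in> C\<close> \<open>v \<in> C\<close> that by auto
    then have "u \<rightarrow>\<^bsub>\<Gamma>\<^esub> w \<longleftrightarrow> v \<rightarrow>\<^bsub>\<Gamma>\<^esub> w"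
      using adj[OF uv(1) that(4)] adj[OF uv(2) that(4)] that(5,6) Z by auto
    then show ?thesis
      using dist[OF uv(1) that(4)] dist[OF uv(2) that(4)] that(5,6) by auto
  qed
  show ?thesis
  proof (intro iffI conjI ballI)
    assume res: "resolving_set \<Gamma> W"
    then show W: "W \<subseteq> verts \<Gamma>"
      by (simp add: resolving_set_def)
    fix C assume C: "C \<in> P"
    have "u = v" if "u \<in> C - W" "v \<in> C - W" for u v
    proof -
      \<comment> \<open>Both \<open>u\<close> and \<open>v\<close> lie outside \<open>W\<close>, so
        every \<open>w\<close> in \<open>W\<close> is a third vertex and sees them as twins.\<close>
      have "\<forall>w\<in>W. graph_dist \<Gamma> u w = graph_dist \<Gamma> v w"
        using twins[OF C] that W by blast
      then show ?thesis
        using res that sub[OF C] unfolding resolving_set_def by blast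
    qed
    then show "card (C - W) \<le> 1"
      using fin[OF C] by (simp add: card_le_Suc0_iff_eq)
  next
    assume asm: "W \<subseteq> verts \<Gamma> \<and> (\<forall>C\<in>P. card (C - W) \<le> 1)"
    have missed: "u = v" if "C \<in> P" "u \<in> C - W" "v \<in> C - W" for C u v
      using asm fin[OF that(1)] that by (auto simp: card_le_Suc0_iff_eq)
    have meets: "\<exists>w. w \<in> C \<inter> W" if C: "C \<in> P" for C
    proof (rule ccontr)
      assume "\<not> ?thesis"
      then have "C - W = C" by blast
      then show False using asm card_P[OF C] C by force
    qed
    have separated: "\<exists>w\<in>W. graph_dist \<Gamma> u w \<noteq> graph_dist \<Gamma> v w"
      if C: "C \<in> P" "C' \<in> P" "C \<noteq> C'" "C' \<noteq> Z" and uv: "u \<in> C - W" "v \<in> C' - W" for u v C C'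
    proof (cases "C = Z")
      case True
      \<comment> \<open>Here \<open>u\<close> is adjacent to everything, so the separating vertex
        has to be a non-neighbour of \<open>v\<close>; any member of \<open>W\<close> in a class
        \<open>D\<close> other than \<open>Z\<close> and \<open>C'\<close> is one.\<close>
      obtain D where D: "D \<in> P - {Z}" "D \<noteq> C'"
        using two by blast
      then obtain w where w: "w \<in> D \<inter> W"
        using meets by blast
      have "u \<noteq> w" "v \<noteq> w" "u \<in> verts \<Gamma>" "v \<in> verts \<Gamma>" "w \<in> verts \<Gamma>"
        using w uv sub C D by blast+
      moreover have "u \<rightarrow>\<^bsub>\<Gamma>\<^esub> w"
        using adj[of u w] calculation True uv by blast
      moreover have "\<not> v \<rightarrow>\<^bsub>\<Gamma>\<^esub> w"
        using class_eq[of C' D v w] C D w uv calculation by blast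
      ultimately show ?thesis
        using w dist[of u w] dist[of v w] by (auto simp: one_ereal_def intro!: bexI[of _ w])
    next
      case False
      \<comment> \<open>Neither class is \<open>Z\<close>, so a member of \<open>W\<close> in
        \<open>C'\<close> is adjacent to \<open>v\<close> but not to \<open>u\<close>.\<close>
      obtain w where w: "w \<in> C' \<inter> W"
        using meets C by blast
      have "u \<noteq> w" "v \<noteq> w" "u \<in> verts \<Gamma>" "v \<in> verts \<Gamma>" "w \<in> verts \<Gamma>"
        using w uv sub C by blast+
      moreover have "v \<rightarrow>\<^bsub>\<Gamma>\<^esub> w"
        using class_eq[of C' C' v w] C w uv calculation by blast
      moreover have "\<not> u \<rightarrow>\<^bsub>\<Gamma>\<^esub> w"
        using class_eq[of C C' u w] C w uv calculation False by blast
      ultimately show ?thesis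
        using w dist[of u w] dist[of v w] by (auto simp: one_ereal_def intro!: bexI[of _ w])
    qed
    show "resolving_set \<Gamma> W"
      unfolding resolving_set_def
    proof (intro conjI ballI impI)
      show "W \<subseteq> verts \<Gamma>" using asm by blast
      fix u v assume uv: "u \<in> verts \<Gamma>" "v \<in> verts \<Gamma>"
        and eq: "\<forall>w\<in>W. graph_dist \<Gamma> u w = graph_dist \<Gamma> v w"
      obtain C C' where C: "C \<in> P" "u \<in> C" "C' \<in> P" "v \<in> C'"
        using uv P(1) by blast
      \<comment> \<open>A vertex of \<open>W\<close> is the only one at distance 0 from itself, so
        only two missed vertices need an argument.\<close>
      consider "u \<in> W" | "v \<in> W" | "u \<notin> W" "v \<notin> W" by blast
      then show "u = v"
      proof cases
        case 1
        with eq uv show ?thesis using dist_eq_0 by metis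
      next
        case 2
        with eq uv show ?thesis using dist_eq_0 by metis
      next
        case 3
        show ?thesis
        proof (cases "C = C'")
          case True
          then show ?thesis using missed 3 C by blast
        next
          case False
          \<comment> \<open>At most one of the two classes is \<open>Z\<close>; exchanging
            \<open>u\<close> and \<open>v\<close> makes it the first one.\<close>
          then consider "C' \<noteq> Z" | "C \<noteq> Z" by blast
          then have "\<exists>w\<in>W. graph_dist \<Gamma> u w \<noteq> graph_dist \<Gamma> v w"
          proof cases
            case 1
            show ?thesis
              by (rule separated[of C C']) (use C 3 False 1 in auto)
          next
            case 2
            have "\<exists>w\<in>W. graph_dist \<Gamma> v w \<noteq> graph_dist \<Gamma> u w"
              by (rule separated[of C' C]) (use C 3 False 2 in auto)
            then show ?thesis by metis
          qed
          then show ?thesis using eq by blast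
        qed
      qed
    qed
  qed
qed

section \<open>Counting partial transversals\<close>

definition partial_transversals :: "'a set set \<Rightarrow> nat \<Rightarrow> 'a set set" where
  "partial_transversals P k = {T. T \<subseteq> \<Union>P \<and> card T = k \<and> (\<forall>C\<in>P. card (C \<inter> T) \<le> 1)}"

text \<open>Complementation is an involution that turns missing at most one vertex of a class into
  containing at most one. The bound on \<open>i\<close> keeps the subtraction from truncating, so
  that complementing back gives size \<open>i\<close>.\<close>

lemma num_resolving_sets_eq_partial_transversals:
  assumes "finite (verts \<Gamma>)" and "\<Union>P = verts \<Gamma>" and "i \<le> card (verts \<Gamma>)"
    and "\<And>W. resolving_set \<Gamma> W \<longleftrightarrow> W \<subseteq> verts \<Gamma> \<and> (\<forall>C\<in>P. card (C - W) \<le> 1)"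
  shows "num_resolving_sets \<Gamma> i = card (partial_transversals P (card (verts \<Gamma>) - i))"
  unfolding num_resolving_sets_def
proof (rule bij_betw_same_card)
  let ?V = "verts \<Gamma>"
  have cap: "C \<inter> (?V - W) = C - W" "C - (?V - W) = C \<inter> W" if "C \<in> P" for C W
    using that assms(2) by auto
  have card_compl: "card (?V - W) = card ?V - card W" if "W \<subseteq> ?V" for W
    using that assms(1) by (simp add: card_Diff_subset finite_subset)
  have compl: "?V - (?V - W) = W" if "W \<subseteq> ?V" for W
    using that by blast
  show "bij_betw (\<lambda>W. ?V - W) {W. resolving_set \<Gamma> W \<and> card W = i}
    (partial_transversals P (card ?V - i))"
  proof (rule bij_betwI[where g = "\<lambda>W. ?V - W"]; (intro funcsetI)?)
    fix W assume "W \<in> {W. resolving_set \<Gamma> W \<and> card W = i}"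
    then show "?V - W \<in> partial_transversals P (card ?V - i)"
      using assms(2) card_compl cap by (simp add: partial_transversals_def assms(4))
  next
    fix T assume "T \<in> partial_transversals P (card ?V - i)"
    then show "?V - T \<in> {W. resolving_set \<Gamma> W \<and> card W = i}"
      using assms(2,3) card_compl cap by (simp add: partial_transversals_def assms(4))
  qed (use assms(2,4) compl in \<open>simp_all add: partial_transversals_def\<close>)
qed

lemma finite_partial_transversals:
  assumes "finite (\<Union>P)"
  shows "finite (partial_transversals P k)"
  using assms by (auto simp: partial_transversals_def intro: finite_subset[of _ "Pow (\<Union>P)"])

text \<open>Finiteness of the union rules out infinite sets, whose \<open>card\<close> is 0 as
  well.\<close>

lemma partial_transversals_0:
  assumes "finite (\<Union>P)"
  shows "partial_transversals P 0 = {{}}"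
  using assms by (auto simp: partial_transversals_def dest: finite_subset)

text \<open>Split by whether the set meets \<open>C\<close>. If it does, it contains exactly one
  \<open>c\<close> of \<open>C\<close>, and removing \<open>c\<close> leaves a partial transversal
  of \<open>P\<close> with one element less; disjointness makes \<open>c\<close> and the rest
  unique.\<close>

lemma card_partial_transversals_insert:
  assumes fin: "finite (\<Union>P)" "finite C" and disj: "C \<inter> \<Union>P = {}"
  shows "card (partial_transversals (insert C P) (Suc k)) =
    card (partial_transversals P (Suc k)) + card C * card (partial_transversals P k)"
proof -
  let ?f = "\<lambda>(c, T). insert c T"
  have finT: "finite T" if "T \<in> partial_transversals P j" for T j
    using that fin by (auto simp: partial_transversals_def intro: finite_subset)
  have C_disj: "C \<inter> T = {}" if "T \<in> partial_transversals P j" for T j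
    using that disj by (auto simp: partial_transversals_def)
  have D_disj: "D \<inter> insert c T = D \<inter> T" if "c \<in> C" "D \<in> P" for c D T
    using that disj by auto
  have "partial_transversals (insert C P) (Suc k) =
      partial_transversals P (Suc k) \<union> ?f ` (C \<times> partial_transversals P k)" (is "?L = ?R")
  proof (intro equalityI subsetI)
    fix T assume T: "T \<in> ?L"
    have finT': "finite T"
      using T fin by (auto simp: partial_transversals_def intro: card_ge_0_finite)
    show "T \<in> ?R"
    proof (cases "C \<inter> T = {}")
      case True
      then show ?thesis
        using T by (auto simp: partial_transversals_def)
    next
      case False
      then obtain c where c: "c \<in> C" "c \<in> T" by blast
      have CT: "C \<inter> T = {c}"
        using T c fin by (auto simp: partial_transversals_def card_le_Suc0_iff_eq)
      have "T - {c} \<in> partial_transversals P k"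
      proof -
        have "D \<inter> (T - {c}) = D \<inter> T" if "D \<in> P" for D
          using that c disj by auto
        moreover have "T - {c} \<subseteq> \<Union>P"
          using T CT by (auto simp: partial_transversals_def)
        ultimately show ?thesis
          using T c finT' by (auto simp: partial_transversals_def)
      qed
      moreover have "T = ?f (c, T - {c})" using c by auto
      ultimately show ?thesis using c by blast
    qed
  next
    fix T assume "T \<in> ?R"
    then show "T \<in> ?L"
    proof
      assume T: "T \<in> partial_transversals P (Suc k)"
      then show ?thesis
        using C_disj[OF T] by (auto simp: partial_transversals_def)
    next
      assume "T \<in> ?f ` (C \<times> partial_transversals P k)"
      then obtain c T' where T: "T = insert c T'" "c \<in> C" "T' \<in> partial_transversals P k"
        by auto
      have "c \<notin> T'" "C \<inter> insert c T' = {c}"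
        using C_disj[OF T(3)] T(2) by auto
      then show ?thesis
        using T finT[OF T(3)] D_disj by (auto simp: partial_transversals_def)
    qed
  qed
  moreover have "inj_on ?f (C \<times> partial_transversals P k)"
  proof (rule inj_onI, clarify)
    fix c T c' T'
    assume c: "c \<in> C" "c' \<in> C" and T: "T \<in> partial_transversals P k" "T' \<in> partial_transversals P k"
      and eq: "insert c T = insert c' T'"
    \<comment> \<open>Since \<open>T'\<close> avoids \<open>C\<close>, the only element of
      \<open>insert c' T'\<close> in \<open>C\<close> is \<open>c'\<close>, which recovers
      \<open>c\<close>.\<close>
    have notin: "c \<notin> T" "c' \<notin> T'" "c \<notin> T'"
      using C_disj[OF T(1)] C_disj[OF T(2)] c by auto
    then have "c = c'" using eq by blast
    then show "c = c' \<and> T = T'" using eq notin insert_ident[of c T T'] by simp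
  qed
  moreover have "partial_transversals P (Suc k) \<inter> ?f ` (C \<times> partial_transversals P k) = {}"
  proof -
    have "insert c T \<notin> partial_transversals P (Suc k)" if "c \<in> C" for c T
      using C_disj[of "insert c T"] that by blast
    then show ?thesis by auto
  qed
  ultimately show ?thesis
    using fin by (simp add: card_Un_disjoint finite_partial_transversals card_image
        card_cartesian_product)
qed

text \<open>Choose the \<open>k\<close> members of \<open>P\<close> that are met, then one of
  \<open>m\<close> elements in each. In the induction, adding one member to \<open>P\<close> becomes
  Pascal's rule.\<close>

lemma card_partial_transversals_uniform:
  assumes "finite P" and "disjoint P" and "\<And>C. C \<in> P \<Longrightarrow> finite C \<and> card C = m"
  shows "card (partial_transversals P k) = m ^ k * (card P choose k)"
  using assms
proof (induction P arbitrary: k rule: finite_induct)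
  case empty
  show ?case
  proof (cases k)
    case (Suc j)
    have "partial_transversals {} k = ({} :: 'a set set)"
      using Suc by (auto simp: partial_transversals_def)
    then show ?thesis using Suc by simp
  qed (simp add: partial_transversals_0)
next
  case (insert C P)
  have IH: "card (partial_transversals P j) = m ^ j * (card P choose j)" for j
    using insert by (intro insert.IH) (auto simp: disjoint_def)
  have fin: "finite (\<Union>P)" "finite C" and disj: "C \<inter> \<Union>P = {}" and "card C = m"
    using insert by (auto simp: disjoint_def)
  show ?case
  proof (cases k)
    case 0
    then show ?thesis using fin by (simp add: partial_transversals_0)
  next
    case (Suc j)
    then show ?thesis
      using insert.hyps \<open>card C = m\<close>
      by (simp add: card_partial_transversals_insert[OF fin disj] IH algebra_simps)
  qed
qed

section \<open>The resolving polynomial without its lower limit\<close>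

text \<open>By minimality all counts below the metric dimension vanish, so the polynomial can be
  evaluated without computing the metric dimension first.\<close>

lemma resolving_polynomial_eq_full_sum:
  assumes "finite (verts \<Gamma>)"
  shows "resolving_polynomial \<Gamma> = (\<Sum>i\<le>card (verts \<Gamma>). monom (int (num_resolving_sets \<Gamma> i)) i)"
  unfolding resolving_polynomial_def
proof (rule sum.mono_neutral_left)
  show "\<forall>i\<in>{..card (verts \<Gamma>)} - {metric_dimension \<Gamma>..card (verts \<Gamma>)}.
      monom (int (num_resolving_sets \<Gamma> i)) i = 0"
  proof
    fix i assume "i \<in> {..card (verts \<Gamma>)} - {metric_dimension \<Gamma>..card (verts \<Gamma>)}"
    then have "i < metric_dimension \<Gamma>" by auto
    then have "\<not> (\<exists>W. resolving_set \<Gamma> W \<and> card W = i)"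
      unfolding metric_dimension_def by (rule not_less_Least)
    then have "{W. resolving_set \<Gamma> W \<and> card W = i} = {}"
      by blast
    then have "num_resolving_sets \<Gamma> i = 0"
      by (simp only: num_resolving_sets_def card.empty)
    then show "monom (int (num_resolving_sets \<Gamma> i)) i = 0" by simp
  qed
qed auto

section \<open>Commutation in the generalized dihedral group\<close>

context comm_group
begin

definition two_torsion :: "'a set" where
  "two_torsion = {g \<in> carrier G. g [^] (2::nat) = \<one>}"

lemma two_torsion_iff: "g \<in> two_torsion \<longleftrightarrow> g \<in> carrier G \<and> g \<otimes> g = \<one>"
  by (auto simp: two_torsion_def numeral_2_eq_2)

lemma subgroup_two_torsion: "subgroup two_torsion G"
proof (rule subgroupI)
  show "two_torsion \<noteq> {}"
    using two_torsion_iff[of \<one>] by auto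
next
  fix g h assume "g \<in> two_torsion" "h \<in> two_torsion"
  moreover have "(g \<otimes> h) \<otimes> (g \<otimes> h) = (g \<otimes> g) \<otimes> (h \<otimes> h)" if "g \<in> carrier G" "h \<in> carrier G"
    using that by (simp add: m_ac)
  ultimately show "g \<otimes> h \<in> two_torsion"
    by (simp add: two_torsion_iff)
next
  fix g assume "g \<in> two_torsion"
  then show "inv g \<in> two_torsion"
    by (simp add: two_torsion_iff flip: inv_mult)
qed (auto simp: two_torsion_iff)

text \<open>The two sides are inverse to each other, and an element equals its inverse iff its
  square is trivial.\<close>

lemma mult_inv_eq_iff_two_torsion:
  assumes "g \<in> carrier G" and "h \<in> carrier G"
  shows "g \<otimes> inv h = h \<otimes> inv g \<longleftrightarrow> g \<otimes> inv h \<in> two_torsion"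
proof -
  have "h \<otimes> inv g = inv (g \<otimes> inv h)"
    using assms by (simp add: inv_mult m_comm)
  moreover have "x = inv x \<longleftrightarrow> x \<otimes> x = \<one>" if "x \<in> carrier G" for x
    using that by (metis inv_equality r_inv)
  ultimately show ?thesis
    using assms by (simp add: two_torsion_iff)
qed

text \<open>Rotations (second component 1) commute. A reflection inverts rotations, so it commutes
  with those equal to their inverse. Two reflections multiply to \<open>g \<otimes> inv h\<close> or
  its inverse, depending on the order.\<close>

lemma gen_dihedral_commute_iff:
  assumes "g \<in> carrier G" and "h \<in> carrier G" and "c \<in> {1, -1}" and "d \<in> {1, -1}"
  shows "(g, c) \<otimes>\<^bsub>gen_dihedral G\<^esub> (h, d) = (h, d) \<otimes>\<^bsub>gen_dihedral G\<^esub> (g, c) \<longleftrightarrow>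
    c = 1 \<and> d = 1 \<or> c = 1 \<and> g \<in> two_torsion \<or> d = 1 \<and> h \<in> two_torsion \<or>
    c = -1 \<and> d = -1 \<and> g \<otimes> inv h \<in> two_torsion"
proof -
  have pow: "x [^] (-1 :: int) = inv x" if "x \<in> carrier G" for x
    using that by (simp add: int_pow_neg)
  have move: "x \<otimes> y = y \<otimes> inv x \<longleftrightarrow> x \<in> two_torsion" if "x \<in> carrier G" "y \<in> carrier G" for x y
    using mult_inv_eq_iff_two_torsion[of x \<one>] that by (simp add: m_comm[of x y])
  show ?thesis
  proof -
    from assms(3,4) consider "c = 1" "d = 1" | "c = 1" "d = -1" | "c = -1" "d = 1" | "c = -1" "d = -1"
      by auto
    then show ?thesis
    proof cases
      case 1
      then show ?thesis using assms(1,2) by (simp add: gen_dihedral_def m_comm[of g h])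
    next
      case 2
      then show ?thesis using assms(1,2) by (simp add: gen_dihedral_def pow move)
    next
      case 3
      have "g \<otimes> inv h = h \<otimes> g \<longleftrightarrow> h \<otimes> g = g \<otimes> inv h" by auto
      then show ?thesis using assms(1,2) 3 by (simp add: gen_dihedral_def pow move)
    next
      case 4
      then show ?thesis
        using assms(1,2) by (simp add: gen_dihedral_def pow mult_inv_eq_iff_two_torsion)
    qed
  qed
qed

text \<open>Turns the commutation criterion for two reflections into membership in a common
  coset.\<close>

lemma same_coset_iff:
  assumes "subgroup H G" and "g \<in> carrier G" and "h \<in> carrier G"
  shows "(\<exists>C\<in>rcosets H. g \<in> C \<and> h \<in> C) \<longleftrightarrow> g \<otimes> inv h \<in> H"
proof -
  interpret subgroup H G by fact
  show ?thesis
  proof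
    assume "\<exists>C\<in>rcosets H. g \<in> C \<and> h \<in> C"
    then obtain x where x: "x \<in> carrier G" "g \<in> H #> x" "h \<in> H #> x"
      by (auto simp: RCOSETS_def)
    then have "H #> x = H #> h"
      using repr_independence assms(1) by blast
    then show "g \<otimes> inv h \<in> H"
      using rcos_module[OF is_group, of h g] x assms by simp
  next
    assume "g \<otimes> inv h \<in> H"
    then have "g \<in> H #> h"
      using rcos_module[OF is_group, of h g] assms by simp
    moreover have "h \<in> H #> h" "H #> h \<in> rcosets H"
      using assms rcos_self rcosetsI[OF subset] by auto
    ultimately show "\<exists>C\<in>rcosets H. g \<in> C \<and> h \<in> C" by blast
  qed
qed

end

section \<open>Twin classes of the commuting graph and the coefficients\<close>

theorem theorem4p4:
  fixes G :: "('a, 'm) monoid_scheme" and n r b :: nat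
    and \<Gamma> :: "('a \<times> int, ('a \<times> int) \<times> ('a \<times> int)) pre_digraph"
    and s :: "nat \<Rightarrow> nat"
  assumes "comm_group G" and "finite (carrier G)" and "Coset.order G = n"
    and "\<not> comm_group (gen_dihedral G)"
    and "r \<ge> 1" and "2 ^ r = card {g \<in> carrier G. g [^]\<^bsub>G\<^esub> (2::nat) = \<one>\<^bsub>G\<^esub>}"
    and "b = n div 2 ^ r"
    and "\<Gamma> = with_proj (commuting_graph (gen_dihedral G) (carrier (gen_dihedral G)))"
    and "s = num_resolving_sets \<Gamma>"
  shows "resolving_polynomial \<Gamma> =
      monom ((int n - 2 ^ r) * (2 ^ r) ^ (b + 1)) (2 * n - b - 2)
      + (\<Sum>i = 2 * n - b - 1..2 * n - 2. monom (int (s i)) i)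
      + monom (2 * int n) (2 * n - 1) + monom 1 (2 * n)
    \<and> (\<forall>i \<in> {2 * n - b - 1..2 * n - 2}.
        int (s i) =
          (int n - 2 ^ r) * (2 ^ r) ^ (2 * n - i - 1) * int ((b + 1) choose (2 * n - i - 1))
          + (2 ^ r) ^ (2 * n - i) * int ((b + 1) choose (2 * n - i)))"
proof -
  interpret comm_group G by (fact assms(1))
  define m :: nat where "m = 2 ^ r"
  define V where "V = carrier (gen_dihedral G)"
  define Z where "Z = two_torsion \<times> {1 :: int}"
  define A where "A = (carrier G - two_torsion) \<times> {1 :: int}"
  define F where "F = (\<lambda>C. C \<times> {-1 :: int}) ` (rcosets\<^bsub>G\<^esub> two_torsion)"
  \<comment> \<open>The classes in \<open>?U\<close> all have size \<open>m\<close>, so the uniform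
    count applies to them; \<open>A\<close> has size \<open>n - m\<close> and is added by the
    recursion.\<close>
  let ?U = "insert Z F" and ?P = "insert A (insert Z F)"
  have sub: "two_torsion \<subseteq> carrier G"
    by (auto simp: two_torsion_def)
  have fin_inv: "finite two_torsion"
    using sub assms(2) finite_subset by blast
  have m: "card two_torsion = m"
    using assms(6) by (simp add: two_torsion_def m_def)
  have m2: "m \<ge> 2"
    using self_le_power[of "2::nat" r] assms(5) by (simp add: m_def)
  have cosets: "card (rcosets\<^bsub>G\<^esub> two_torsion) * m = n"
    using lagrange[OF subgroup_two_torsion] m assms(3) by simp
  then have b: "card (rcosets\<^bsub>G\<^esub> two_torsion) = b"
    using m2 assms(7) by (metis m_def nonzero_mult_div_cancel_right not_numeral_le_zero)
  have fin_cosets: "finite (rcosets\<^bsub>G\<^esub> two_torsion)"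
    using assms(2) rcosets_part_G[OF subgroup_two_torsion] by (metis finite_UnionD)
  \<comment> \<open>If \<open>b\<close> were at most 1, every element of \<open>G\<close> would have
    order at most 2 and the dihedral group would be abelian.\<close>
  have "b \<ge> 2"
  proof (rule ccontr)
    assume "\<not> ?thesis"
    then have "n \<le> m" using cosets b by (cases b) auto
    then have "two_torsion = carrier G"
      using m assms(3) card_seteq[OF assms(2) sub] by (simp add: Coset.order_def)
    then have "x \<otimes>\<^bsub>gen_dihedral G\<^esub> y = y \<otimes>\<^bsub>gen_dihedral G\<^esub> x"
      if "x \<in> V" "y \<in> V" for x y
    proof -
      obtain g c h d where "x = (g, c)" "y = (h, d)"
        "g \<in> carrier G" "h \<in> carrier G" "c \<in> {1, -1}" "d \<in> {1, -1}"
        using \<open>x \<in> V\<close> \<open>y \<in> V\<close> by (auto simp: V_def gen_dihedral_def)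
      then show ?thesis
        using gen_dihedral_commute_iff[of g h c d] \<open>two_torsion = carrier G\<close> by auto
    qed
    then have "comm_group (gen_dihedral G)"
      unfolding V_def
      using group.group_comm_groupI[OF group_gen_dihedral[OF assms(1)]] by blast
    then show False using assms(4) by blast
  qed
  have bm: "b * m = n" using cosets b by simp
  have n_ge: "n \<ge> 2 * m" using bm \<open>b \<ge> 2\<close> by (metis mult_le_mono1)
  \<comment> \<open>Together with \<open>b \<ge> 2\<close> this keeps the subtractions in the
    exponents from truncating.\<close>
  have n_b: "n \<ge> 2 * b" using bm m2 by (metis mult.commute mult_le_mono1)
  have card_F: "card F = b" and fin_F: "finite F"
  proof -
    have "inj_on (\<lambda>C. C \<times> {-1 :: int}) (rcosets\<^bsub>G\<^esub> two_torsion)"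
      by (rule inj_onI) (auto simp: times_eq_iff)
    then show "card F = b" "finite F"
      unfolding F_def using b fin_cosets by (auto simp: card_image)
  qed
  have card_U: "card ?U = b + 1"
  proof -
    \<comment> \<open>The identity tells \<open>Z\<close> from the members of \<open>F\<close>, so
      \<open>Z\<close> counts as a further class.\<close>
    have "(\<one>\<^bsub>G\<^esub>, 1) \<in> Z" "(\<one>\<^bsub>G\<^esub>, 1) \<notin> \<Union>F"
      by (auto simp: Z_def F_def two_torsion_iff)
    then have "Z \<notin> F" by blast
    then show ?thesis using card_F fin_F by simp
  qed
  have V: "verts \<Gamma> = V" and finV: "finite V" and cardV: "card V = 2 * n"
    using assms(2,3) by (auto simp: assms(8) V_def commuting_graph_def gen_dihedral_def
        card_cartesian_product Coset.order_def)
  have cover: "\<Union>?P = V"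
    using sub rcosets_part_G[OF subgroup_two_torsion]
    by (auto simp: A_def Z_def F_def V_def gen_dihedral_def)
  have disj_U: "disjoint ?U" and disj_A: "A \<inter> \<Union>?U = {}"
    using rcos_disjoint[OF subgroup_two_torsion]
    by (auto simp: A_def Z_def F_def disjoint_def)
  have uniform: "finite C \<and> card C = m" if "C \<in> ?U" for C
    using that m fin_inv card_rcosets_equal[OF _ sub] rcosets_finite[OF _ sub fin_inv]
    by (auto simp: Z_def F_def card_cartesian_product)
  have card_A: "card A = n - m"
    using m fin_inv sub assms(3) by (simp add: A_def card_Diff_subset Coset.order_def
        card_cartesian_product)
  have fin_U: "finite (\<Union>?U)" and fin_A: "finite A"
    using cover finV by (auto intro: finite_subset)
  \<comment> \<open>Two commuting rotations are both in \<open>A\<close> or one of them is in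
    \<open>Z\<close>; a rotation and a reflection commute only through \<open>Z\<close>; commuting
    reflections share a member of \<open>F\<close>.\<close>
  have dom: "u \<rightarrow>\<^bsub>\<Gamma>\<^esub> v \<longleftrightarrow> u \<noteq> v \<and> (u \<in> Z \<or> v \<in> Z \<or> (\<exists>C\<in>?P. u \<in> C \<and> v \<in> C))"
    if "u \<in> verts \<Gamma>" "v \<in> verts \<Gamma>" for u v
  proof -
    obtain g c h d where gh: "u = (g, c)" "v = (h, d)" by fastforce
    have carr: "g \<in> carrier G" "h \<in> carrier G" "c \<in> {1, -1}" "d \<in> {1, -1}"
      using that gh by (auto simp: V V_def gen_dihedral_def)
    have "(\<exists>C\<in>F. u \<in> C \<and> v \<in> C) \<longleftrightarrow> c = -1 \<and> d = -1 \<and> g \<otimes>\<^bsub>G\<^esub> inv\<^bsub>G\<^esub> h \<in> two_torsion"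
      using same_coset_iff[OF subgroup_two_torsion carr(1,2)] gh by (auto simp: F_def)
    then have "(u \<in> Z \<or> v \<in> Z \<or> (\<exists>C\<in>?P. u \<in> C \<and> v \<in> C)) \<longleftrightarrow>
        u \<otimes>\<^bsub>gen_dihedral G\<^esub> v = v \<otimes>\<^bsub>gen_dihedral G\<^esub> u"
      using gen_dihedral_commute_iff[OF carr] carr gh by (auto simp: Z_def A_def)
    then show ?thesis
      using that by (auto simp: assms(8) commuting_graph_def V_def)
  qed
  have resolving: "resolving_set \<Gamma> W \<longleftrightarrow> W \<subseteq> verts \<Gamma> \<and> (\<forall>C\<in>?P. card (C - W) \<le> 1)" for W
  proof -
    have "wf_digraph \<Gamma>"
    proof -
      interpret pair_graph "commuting_graph (gen_dihedral G) V"
        by (rule pair_graph_commuting_graph[OF finV])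
      show ?thesis using wf_digraph_axioms by (simp add: assms(8) V_def)
    qed
    moreover obtain C1 C2 where "C1 \<in> F" "C2 \<in> F" "C1 \<noteq> C2"
      using card_F \<open>b \<ge> 2\<close> fin_F by (metis card_le_Suc0_iff_eq not_less_eq_eq numeral_2_eq_2)
    moreover have "Z \<notin> F"
      using card_U card_F fin_F by (auto simp: insert_absorb)
    moreover have "disjoint ?P"
      using disj_U disj_A by (auto simp: pairwise_insert disjnt_def)
    moreover have "2 \<le> card C" if "C \<in> ?P" for C
      using that uniform[of C] card_A n_ge m2 by auto
    ultimately show ?thesis
      using cover V dom by (intro resolving_set_iff_twin_classes[of _ _ Z C1 C2]) blast+
  qed
  have s_pt: "s i = card (partial_transversals ?P (2 * n - i))" if "i \<le> 2 * n" for i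
    using num_resolving_sets_eq_partial_transversals[OF _ _ _ resolving] that cover V finV cardV
    by (simp add: assms(9))
  have pt_Suc: "card (partial_transversals ?P (Suc k)) =
      m ^ Suc k * ((b + 1) choose Suc k) + (n - m) * (m ^ k * ((b + 1) choose k))" for k
    using card_partial_transversals_insert[OF fin_U fin_A disj_A] card_A
      card_partial_transversals_uniform[OF _ disj_U uniform] fin_F card_U by simp
  \<comment> \<open>The complement has positive size here, as the recursion demands; the whole
    vertex set is treated separately.\<close>
  have s_formula: "s i = (n - m) * m ^ (2 * n - i - 1) * ((b + 1) choose (2 * n - i - 1))
      + m ^ (2 * n - i) * ((b + 1) choose (2 * n - i))" if "i < 2 * n" for i
  proof -
    have "2 * n - i = Suc (2 * n - i - 1)" using that by simp
    then show ?thesis using s_pt[of i] pt_Suc[of "2 * n - i - 1"] that by simp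
  qed
  have s_top: "s (2 * n) = 1"
    using s_pt[of "2 * n"] partial_transversals_0[of ?P] finV unfolding cover by simp
  \<comment> \<open>The formula gives \<open>(n - m) + m * (b + 1)\<close>, which is
    \<open>2 * n\<close> because \<open>b * m = n\<close>.\<close>
  have s_top': "s (2 * n - 1) = 2 * n"
    using s_formula[of "2 * n - 1"] n_ge m2 bm by (simp add: algebra_simps)
  \<comment> \<open>The complement takes one vertex from each of the \<open>b + 2\<close> classes;
    the summand for sets avoiding \<open>A\<close> vanishes, as \<open>b + 1\<close> classes cannot
    supply \<open>b + 2\<close> vertices.\<close>
  have s_min: "s (2 * n - b - 2) = (n - m) * m ^ (b + 1)"
  proof -
    have "2 * n - (2 * n - b - 2) = b + 2" using n_b \<open>b \<ge> 2\<close> by simp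
    then show ?thesis using s_formula[of "2 * n - b - 2"] n_b \<open>b \<ge> 2\<close> by simp
  qed
  \<comment> \<open>The complement would have more vertices than there are classes, so both
    binomials vanish.\<close>
  have s_below: "s i = 0" if "i < 2 * n - b - 2" for i
  proof -
    have "i < 2 * n" "b + 1 < 2 * n - i - 1" "b + 1 < 2 * n - i" using that by linarith+
    then show ?thesis using s_formula[of i] by (simp add: binomial_eq_0)
  qed
  have int_diff: "int (n - m) = int n - 2 ^ r"
    using n_ge by (simp add: m_def of_nat_diff)
  let ?f = "\<lambda>i. monom (int (s i)) i" and ?k = "2 * n - b - 2"
  let ?I = "{2 * n - b - 1..2 * n - 2}"
  have "resolving_polynomial \<Gamma> = sum ?f {..2 * n}"
    using resolving_polynomial_eq_full_sum[of \<Gamma>] V finV cardV assms(9) by simp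
  \<comment> \<open>The listed indices are exactly those from \<open>2 * n - b - 2\<close> to
    \<open>2 * n\<close>; all lower coefficients are zero.\<close>
  also have "\<dots> = sum ?f (insert ?k (insert (2 * n - 1) (insert (2 * n) ?I)))"
    using n_b \<open>b \<ge> 2\<close> s_below by (intro sum.mono_neutral_right) auto
  also have "\<dots> = ?f ?k + (?f (2 * n - 1) + (?f (2 * n) + sum ?f ?I))"
  proof -
    have "?k \<notin> insert (2 * n - 1) (insert (2 * n) ?I)" "2 * n - 1 \<notin> insert (2 * n) ?I"
      "2 * n \<notin> ?I"
      using n_b \<open>b \<ge> 2\<close> by auto
    then show ?thesis by (simp only: sum.insert finite_insert finite_atLeastAtMost not_False_eq_True)
  qed
  also have "\<dots> = monom ((int n - 2 ^ r) * (2 ^ r) ^ (b + 1)) ?k + sum ?f ?I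
      + monom (2 * int n) (2 * n - 1) + monom 1 (2 * n)"
    unfolding s_top s_top' s_min of_nat_mult int_diff by (simp add: m_def ac_simps)
  finally have "resolving_polynomial \<Gamma> =
      monom ((int n - 2 ^ r) * (2 ^ r) ^ (b + 1)) ?k + sum ?f ?I
      + monom (2 * int n) (2 * n - 1) + monom 1 (2 * n)" .
  moreover have "int (s i) =
      (int n - 2 ^ r) * (2 ^ r) ^ (2 * n - i - 1) * int ((b + 1) choose (2 * n - i - 1))
      + (2 ^ r) ^ (2 * n - i) * int ((b + 1) choose (2 * n - i))"
    if "i \<in> ?I" for i
  proof -
    have "i < 2 * n" using that n_b \<open>b \<ge> 2\<close> by auto
    then show ?thesis
      unfolding s_formula[OF \<open>i < 2 * n\<close>] of_nat_add of_nat_mult int_diff by (simp add: m_def)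
  qed
  ultimately show ?thesis by blast
qed

end
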